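(* Let $f(\bm w)=\mathbb{E}_{\xi\sim\mathcal D}f(\bm w;\xi)$ on $\mathbb{R}^d$ satisfy the heavy-tailed noise assumption (constants $\sigma>0$, $p\in(1,2]$) and the individual Lipschitz assumption (constants $L>0$, $B$) given in the context, and let $T\ge1$ be an integer. Let $(\bm w^t)_{t\ge0}$ be generated by the NSGD-VR algorithm (see context) with $$1-\theta=\min\Big\{\frac{1}{\sigma^{\frac{p}{2p-1}}T^{\frac{p}{2p-1}}},1\Big\},\qquad \gamma=\frac{\sqrt[4]{1-\theta}}{L\sqrt T}.$$ Then $$\begin{aligned} \frac1T\sum_{t=1}^T\mathbb{E}\|\nabla f(\bm w^t)\|\le{}&\frac{2\|\nabla f(\bm w^0)\|\sigma^{\frac{p}{2p-1}}+4\big(\frac BL+1\big)^{\frac{2-p}{2}}\sigma^{\frac{p}{2p-1}}+4\big(\frac BL+1\big)^{\frac{2-p}{2}}\sigma^{\frac{p}{4(2p-1)}}}{T^{\frac{p-1}{2p-1}}}\\ &+\frac{[L(f(\bm w^0)-\min f)+5]\sigma^{\frac{p}{4(2p-1)}}}{T^{\frac{p-1}{2p-1}}}+\frac{L(f(\bm w^0)-\min f)+4\big(\frac BL+1\big)^{\frac{2-p}{2}}+5}{\sqrt T}+\frac{2\|\nabla f(\bm w^0)\|}{T}. \end{aligned}$$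
   Context: Setting: $\mathcal D$ is a probability distribution on a sample space $\Xi$; $f(\bm w)=\mathbb{E}_{\xi\sim\mathcal D}f(\bm w;\xi)$, $\bm w\in\mathbb{R}^d$, with all functions differentiable in $\bm w$. $\|\cdot\|$ is the Euclidean norm; $\min f$ is the minimum value of $f$ (understood as its infimum, assumed finite). Heavy-tailed noise assumption: $\sigma>0$ and $p\in(1,2]$ satisfy $\sup_{\bm w\in\mathbb{R}^d}\mathbb{E}_{\xi\sim\mathcal D}\|\nabla f(\bm w;\xi)-\nabla f(\bm w)\|^p\le\sigma^p$. Individual Lipschitz assumption: there is $L>0$ with $\|\nabla f(\bm y;\xi)-\nabla f(\bm x;\xi)\|\le L\|\bm y-\bm x\|$ for all $\bm x,\bm y\in\mathbb{R}^d$ and all $\xi$; $\mathbb{E}_{\xi\sim\mathcal D}[\nabla f(\bm w;\xi)]=\nabla f(\bm w)$ for all $\bm w$; at the (deterministic) initial point $\bm w^0$, $B:=\sup_{\xi\sim\mathcal D}\|\nabla f(\bm w^0;\xi)\|<+\infty$ almost surely, with $B>0$; and $\inf_{\bm w} f(\bm w;\xi)>-\infty$ for each $\xi$. NSGD-VR algorithm (parameters $\gamma>0$, $0\le\theta<1$): initialize $\bm w^0=\bm w^1$, $\bm m^0=\bm 0$. For $t=1,2,\dots$: sample $\xi^t\sim\mathcal D$ (independently of the past), set $\bm m^t=\theta\bm m^{t-1}+\nabla f(\bm w^t;\xi^t)-\theta\nabla f(\bm w^{t-1};\xi^t)$ and $\bm w^{t+1}=\bm w^t-\gamma\,\bm m^t/\|\bm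 m^t\|$ (with $\bm m/\|\bm m\|$ read as $\bm 0$ if $\bm m=\bm 0$). *)

theory Defs
  imports "HOL-Probability.Probability"
begin

definition gradient :: "('v::real_inner \<Rightarrow> real) \<Rightarrow> 'v \<Rightarrow> 'v" where
  "gradient h w = (THE v. GDERIV h w :> v)"

lemma GDERIV_gradient:
  fixes h :: "'v::euclidean_space \<Rightarrow> real"
  assumes "h differentiable (at w)"
  shows "GDERIV h w :> gradient h w"
proof -
  obtain h' where h': "(h has_derivative h') (at w)"
    using assms by (auto simp: differentiable_def)
  have lin: "linear h'"
    using h' by (rule has_derivative_linear)
  have eq: "(\<lambda>x. x \<bullet> adjoint h' 1) = h'"
  proof
    show "x \<bullet> adjoint h' 1 = h' x" for x
      using adjoint_works[OF lin, of x 1] by simp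
  qed
  have G: "GDERIV h w :> adjoint h' 1"
    unfolding gderiv_def eq by (rule h')
  have "v = adjoint h' 1" if "GDERIV h w :> v" for v
  proof -
    have "(\<lambda>x. x \<bullet> v) = (\<lambda>x. x \<bullet> adjoint h' 1)"
      using that G unfolding gderiv_def by (rule has_derivative_unique)
    then have "\<forall>x. x \<bullet> v = x \<bullet> adjoint h' 1"
      by (rule fun_cong[THEN allI])
    then show ?thesis
      by (simp only: vector_eq_ldot)
  qed
  with G show ?thesis
    unfolding gradient_def by (rule theI)
qed

definition objective :: "'x measure \<Rightarrow> ('v \<Rightarrow> 'x \<Rightarrow> real) \<Rightarrow> 'v \<Rightarrow> real" where
  "objective D f w = (\<integral>\<xi>. f w \<xi> \<partial>D)"

definition stochastic_objective ::
  "'x measure \<Rightarrow> ('v::real_inner \<Rightarrow> 'x \<Rightarrow> real) \<Rightarrow> bool" where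
  "stochastic_objective D f \<longleftrightarrow>
     prob_space D \<and>
     (\<forall>w. integrable D (f w)) \<and>
     (\<forall>\<xi>\<in>space D. \<forall>w. (\<lambda>v. f v \<xi>) differentiable (at w)) \<and>
     (\<forall>w. objective D f differentiable (at w))"

text \<open>
  The moment is a nonnegative integral, so that the bound also forces it to be finite.
\<close>

definition heavy_tailed_noise ::
  "'x measure \<Rightarrow> ('v::real_inner \<Rightarrow> 'x \<Rightarrow> real) \<Rightarrow> real \<Rightarrow> real \<Rightarrow> bool" where
  "heavy_tailed_noise D f \<sigma> p \<longleftrightarrow>
     \<sigma> > 0 \<and> 1 < p \<and> p \<le> 2 \<and>
     (SUP w. \<integral>\<^sup>+ \<xi>. ennreal (norm (gradient (\<lambda>v. f v \<xi>) w - gradient (objective D f) w) powr p) \<partial>D)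
       \<le> ennreal (\<sigma> powr p)"

text \<open>
  The supremum over samples \<open>\<xi> \<sim> D\<close> is the essential supremum with respect to \<open>D\<close>;
  equating it with the real number \<open>B\<close> makes it finite.
\<close>

definition individual_Lipschitz ::
  "'x measure \<Rightarrow> ('v::euclidean_space \<Rightarrow> 'x \<Rightarrow> real) \<Rightarrow> 'v \<Rightarrow> real \<Rightarrow> real \<Rightarrow> bool" where
  "individual_Lipschitz D f w0 L B \<longleftrightarrow>
     L > 0 \<and>
     (\<forall>\<xi>\<in>space D. \<forall>x y.
        norm (gradient (\<lambda>v. f v \<xi>) y - gradient (\<lambda>v. f v \<xi>) x) \<le> L * norm (y - x)) \<and>
     (\<forall>w. has_bochner_integral D (\<lambda>\<xi>. gradient (\<lambda>v. f v \<xi>) w) (gradient (objective D f) w)) \<and>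
     B > 0 \<and>
     esssup D (\<lambda>\<xi>. ereal (norm (gradient (\<lambda>v. f v \<xi>) w0))) = ereal B \<and>
     (\<forall>\<xi>\<in>space D. bdd_below (range (\<lambda>w. f w \<xi>)))"

definition iid_samples ::
  "'o measure \<Rightarrow> 'x measure \<Rightarrow> (nat \<Rightarrow> 'o \<Rightarrow> 'x) \<Rightarrow> bool" where
  "iid_samples P D \<xi> \<longleftrightarrow>
     prob_space P \<and>
     prob_space.indep_vars P (\<lambda>_. D) \<xi> {1..} \<and>
     (\<forall>t\<ge>1. distr P D (\<xi> t) = D)"

text \<open>
  A single trajectory of the algorithm, for a fixed sequence of samples \<open>\<xi> 1, \<xi> 2, \<dots>\<close>.
  The normalized direction is \<open>sgn (m t)\<close>, which is \<open>m t /\<^sub>R norm (m t)\<close> with \<open>sgn 0 = 0\<close>.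
\<close>

definition NSGD_VR ::
  "('v::euclidean_space \<Rightarrow> 'x \<Rightarrow> real) \<Rightarrow> real \<Rightarrow> real \<Rightarrow> 'v \<Rightarrow>
   (nat \<Rightarrow> 'x) \<Rightarrow> (nat \<Rightarrow> 'v) \<Rightarrow> (nat \<Rightarrow> 'v) \<Rightarrow> bool" where
  "NSGD_VR f \<gamma> \<theta> w0 \<xi> w m \<longleftrightarrow>
     w 0 = w0 \<and> w 1 = w0 \<and> m 0 = 0 \<and>
     (\<forall>t\<ge>1.
        m t = \<theta> *\<^sub>R m (t - 1) + gradient (\<lambda>v. f v (\<xi> t)) (w t)
              - \<theta> *\<^sub>R gradient (\<lambda>v. f v (\<xi> t)) (w (t - 1)) \<and>
        w (t + 1) = w t - \<gamma> *\<^sub>R sgn (m t))"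

end

theory Submission
  imports Defs
begin

text \<open>
  Write \<open>S\<^sub>t\<close> for the gradient noise at \<open>w\<^sup>t\<close> and \<open>Z\<^sub>t\<close> for the difference of the noises of
  sample \<open>\<xi>\<^sup>t\<close> at \<open>w\<^sup>t\<close> and \<open>w\<^sup>t\<^sup>-\<^sup>1\<close>. The error of the momentum splits as
  \<open>m\<^sup>t - \<nabla>F(w\<^sup>t) = u\<^sub>t + z\<^sub>t - \<theta>\<^sup>t \<nabla>F(w\<^sup>0)\<close>, where \<open>u\<^sub>t = \<theta> u\<^sub>t\<^sub>-\<^sub>1 + (1 - \<theta>) S\<^sub>t\<close> and
  \<open>z\<^sub>t = \<theta> z\<^sub>t\<^sub>-\<^sub>1 + \<theta> Z\<^sub>t\<close>. Both are discounted sums of martingale differences: the first is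
  controlled in its \<open>p\<close>-th moment by the noise assumption, the second in its second moment since
  \<open>\<parallel>Z\<^sub>t\<parallel> \<le> 2 L \<gamma>\<close> pathwise. Telescoping the descent inequality of a normalised step turns bounds on
  the error into the bound on the gradients.
\<close>

section \<open>Joint measurability of functions continuous in one variable\<close>

text \<open>Stochastic gradients are evaluated at random iterates, so measurability in the sample
  for each fixed point is not enough. Rounding the point to a countable dense set gives jointly
  measurable approximations, and continuity makes them converge pointwise.\<close>

lemma measurable_Caratheodory:
  fixes G :: "'v::{metric_space,second_countable_topology} \<Rightarrow> 'x \<Rightarrow> 'w::metric_space"
  assumes meas: "\<And>v. G v \<in> borel_measurable D"
    and cont: "\<And>x. x \<in> space D \<Longrightarrow> continuous_on UNIV (\<lambda>v. G v x)"
  shows "(\<lambda>(v, x). G v x) \<in> borel_measurable (borel \<Otimes>\<^sub>M D)"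
proof -
  obtain E :: "'v set" where "countable E" and E: "\<And>X. open X \<Longrightarrow> X \<noteq> {} \<Longrightarrow> \<exists>d\<in>E. d \<in> X"
    using countable_dense_exists by blast
  define d where "d = from_nat_into E"
  have dense: "\<exists>k. dist v (d k) < \<epsilon>" if "\<epsilon> > 0" for v \<epsilon>
  proof -
    obtain y where "y \<in> E" "y \<in> ball v \<epsilon>"
      using E[of "ball v \<epsilon>"] \<open>\<epsilon> > 0\<close> by auto
    with \<open>countable E\<close> show ?thesis
      unfolding d_def by (metis from_nat_into_surj mem_ball)
  qed
  \<comment> \<open>Taking the least admissible index makes the rounding a measurable map into a
    countable set, so that the rounded function is a countable gluing of measurable functions of the
    sample.\<close>
  define k where "k n v = (LEAST k. dist v (d k) < 1 / real (Suc n))" for n v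
  have k: "dist v (d (k n v)) < 1 / real (Suc n)" for n v
    unfolding k_def by (rule LeastI_ex) (simp add: dense)
  have [measurable]: "k n \<in> measurable borel (count_space UNIV)" for n
    unfolding k_def by measurable
  show ?thesis
  proof (rule borel_measurable_LIMSEQ_metric)
    show "(\<lambda>z. G (d (k n (fst z))) (snd z)) \<in> borel_measurable (borel \<Otimes>\<^sub>M D)" for n
    proof (rule measurable_compose_countable)
      show "(\<lambda>z. G (d i) (snd z)) \<in> borel_measurable (borel \<Otimes>\<^sub>M D)" for i
        using meas[measurable] by measurable
    qed measurable
  next
    fix z :: "'v \<times> 'x"
    assume "z \<in> space (borel \<Otimes>\<^sub>M D)"
    then obtain v x where z: "z = (v, x)" and "x \<in> space D"
      by (auto simp: space_pair_measure)
    have "(\<lambda>n. dist (d (k n v)) v) \<longlonglongrightarrow> 0"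
      by (rule tendsto_sandwich[OF _ _ tendsto_const LIMSEQ_Suc[OF lim_1_over_n]])
         (use k in \<open>auto intro!: always_eventually less_imp_le simp: dist_commute\<close>)
    then have "(\<lambda>n. d (k n v)) \<longlonglongrightarrow> v"
      by (rule iffD2[OF tendsto_dist_iff])
    then have "(\<lambda>n. G (d (k n v)) x) \<longlonglongrightarrow> G v x"
      using cont[OF \<open>x \<in> space D\<close>]
      by (auto simp: continuous_on_eq_continuous_at intro: isCont_tendsto_compose)
    then show "(\<lambda>n. G (d (k n (fst z))) (snd z)) \<longlonglongrightarrow> (case z of (v, x) \<Rightarrow> G v x)"
      by (simp add: z)
  qed
qed

section \<open>Inequalities for real powers\<close>

text \<open>This is weighted AM-GM with weights \<open>1 / q\<close> and \<open>1 - 1 / q\<close>.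
  Read in \<open>x\<close>, it says that \<open>x powr q\<close> lies above its tangent at
  \<open>c\<close>, which is the form needed for Jensen's inequality.\<close>

lemma Young_powr:
  fixes x c q :: real
  assumes "x \<ge> 0" "c \<ge> 0" "q \<ge> 1"
  shows "q * (x * c powr (q - 1)) \<le> x powr q + (q - 1) * c powr q"
proof (cases "x = 0 \<or> c = 0")
  case False
  then have pos: "x > 0" "c > 0"
    using assms by auto
  have "(x powr q) powr (1 / q) * (c powr q) powr (1 - 1 / q) \<le> 1 / q * x powr q + (1 - 1 / q) * c powr q"
    using assms pos by (intro Youngs_inequality_0) auto
  moreover have "(x powr q) powr (1 / q) = x" "(c powr q) powr (1 - 1 / q) = c powr (q - 1)"
    using assms pos by (simp_all add: powr_powr algebra_simps)
  ultimately have "q * (x * c powr (q - 1)) \<le> q * (1 / q * x powr q + (1 - 1 / q) * c powr q)"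
    using assms by (intro mult_left_mono) auto
  also have "\<dots> = x powr q + (q - 1) * c powr q"
    using assms by (simp add: field_simps)
  finally show ?thesis .
qed (use assms in auto)

text \<open>The shares \<open>a / (a + b)\<close> and \<open>b / (a + b)\<close> sum to 1, and a
  number in [0,1] does not decrease when raised to a power \<open>r\<close> in (0,1].\<close>

lemma powr_subadditive:
  fixes a b r :: real
  assumes "a \<ge> 0" "b \<ge> 0" "0 < r" "r \<le> 1"
  shows "(a + b) powr r \<le> a powr r + b powr r"
proof (cases "a + b = 0")
  case False
  then have s: "a + b > 0"
    using assms by simp
  have le: "x / (a + b) \<le> (x / (a + b)) powr r" if "0 \<le> x" "x \<le> a + b" for x
  proof (cases "x = 0")
    case False
    then show ?thesis
      using powr_mono'[of r 1 "x / (a + b)"] that s assms by simp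
  qed simp
  have "1 = a / (a + b) + b / (a + b)"
    using s by (simp add: add_divide_distrib[symmetric])
  also have "\<dots> \<le> (a / (a + b)) powr r + (b / (a + b)) powr r"
    using assms by (intro add_mono le) auto
  also have "\<dots> = (a powr r + b powr r) / (a + b) powr r"
    using assms s by (simp add: powr_divide add_divide_distrib)
  finally show ?thesis
    using s by (simp add: field_simps)
qed (use assms in auto)

text \<open>Midpoint concavity, obtained from the tangent at the midpoint \<open>M\<close>: weighted
  AM-GM bounds each of the two powers times \<open>M powr (1 - r)\<close>, and the two bounds add up
  to \<open>2 * M\<close>.\<close>

lemma powr_add_le_midpoint:
  fixes a b r :: real
  assumes "a \<ge> 0" "b \<ge> 0" "0 < r" "r \<le> 1"
  shows "a powr r + b powr r \<le> 2 * ((a + b) / 2) powr r"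
proof (cases "a + b = 0")
  case False
  define M where "M = (a + b) / 2"
  have M: "M > 0"
    using False assms by (simp add: M_def)
  have le: "x powr r * M powr (1 - r) \<le> r * x + (1 - r) * M" if "x \<ge> 0" for x
  proof (cases "x = 0")
    case False
    then show ?thesis
      using Youngs_inequality_0[of r "1 - r" x M] that M assms by simp
  qed (use M assms in auto)
  have "(a powr r + b powr r) * M powr (1 - r) \<le> r * (a + b) + 2 * (1 - r) * M"
    using le[of a] le[of b] assms by (simp add: algebra_simps)
  also have "r * (a + b) + 2 * (1 - r) * M = 2 * M"
    by (simp add: M_def field_simps)
  also have "\<dots> = 2 * M powr r * M powr (1 - r)"
    using M by (simp add: powr_add[symmetric])
  finally show ?thesis
    using M by (simp add: M_def)
qed (use assms in \<open>auto simp: add_nonneg_eq_0_iff\<close>)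

text \<open>In terms of squared norms the exponent becomes \<open>q / 2\<close>, which is at most 1.
  Concavity merges the two terms on the left, the parallelogram identity evaluates the average of
  the squares, and subadditivity splits the result.\<close>

lemma norm_powr_parallelogram:
  fixes x y :: "'v::real_inner"
  assumes "0 < q" "q \<le> 2"
  shows "norm (x + y) powr q + norm (x - y) powr q \<le> 2 * norm x powr q + 2 * norm y powr q"
proof -
  have sq: "(norm z)\<^sup>2 powr (q / 2) = norm z powr q" for z :: 'v
    by (cases "z = 0") (use assms in \<open>auto simp: powr_powr powr_numeral[symmetric] simp del: powr_numeral\<close>)
  have "norm (x + y) powr q + norm (x - y) powr q
      \<le> 2 * (((norm (x + y))\<^sup>2 + (norm (x - y))\<^sup>2) / 2) powr (q / 2)"
    unfolding sq[symmetric] using assms by (intro powr_add_le_midpoint) auto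
  also have "((norm (x + y))\<^sup>2 + (norm (x - y))\<^sup>2) / 2 = (norm x)\<^sup>2 + (norm y)\<^sup>2"
    by (simp add: power2_norm_eq_inner inner_simps inner_commute)
  also have "\<dots> powr (q / 2) \<le> (norm x)\<^sup>2 powr (q / 2) + (norm y)\<^sup>2 powr (q / 2)"
    using assms by (intro powr_subadditive) auto
  finally show ?thesis
    by (simp add: sq)
qed

section \<open>Moment inequalities on a probability space\<close>

text \<open>Jensen's inequality, by integrating the tangent bound \<open>Young_powr\<close> at the
  mean of \<open>R\<close>. With a nonnegative integral on the right, an infinite moment is a
  trivial case.\<close>

lemma (in prob_space) expectation_powr_le:
  fixes R :: "'a \<Rightarrow> real"
  assumes R: "integrable M R" "\<And>x. x \<in> space M \<Longrightarrow> R x \<ge> 0" and q: "q \<ge> 1"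
  shows "ennreal (expectation R powr q) \<le> (\<integral>\<^sup>+ x. ennreal (R x powr q) \<partial>M)"
proof (cases "(\<integral>\<^sup>+ x. ennreal (R x powr q) \<partial>M) = \<infinity>")
  case False
  have [measurable]: "R \<in> borel_measurable M"
    using R by auto
  have I: "integrable M (\<lambda>x. R x powr q)"
    using False by (intro integrableI_nonneg) (auto simp: top.not_eq_extremum)
  define c where "c = expectation R"
  have c: "c \<ge> 0"
    unfolding c_def using R by (intro integral_nonneg_AE) auto
  have "expectation (\<lambda>x. q * (R x * c powr (q - 1)))
      \<le> expectation (\<lambda>x. R x powr q + (q - 1) * c powr q)"
    using R I q c by (intro integral_mono) (auto intro!: Young_powr)
  also have "\<dots> = expectation (\<lambda>x. R x powr q) + (q - 1) * c powr q"
    using I by (simp add: prob_space)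
  finally have "q * (c * c powr (q - 1)) \<le> expectation (\<lambda>x. R x powr q) + (q - 1) * c powr q"
    using R by (simp add: c_def)
  moreover have "c * c powr (q - 1) = c powr q"
    using c by (cases "c = 0") (auto simp: powr_mult_base)
  ultimately have "c powr q \<le> expectation (\<lambda>x. R x powr q)"
    by (simp add: algebra_simps)
  then show ?thesis
    using I by (simp add: nn_integral_eq_integral c_def)
qed simp

text \<open>Integrability follows by domination with \<open>1 + norm (X x) powr q\<close>; the bound
  on the mean is Jensen's inequality followed by a \<open>q\<close>-th root.\<close>

lemma (in prob_space) integrable_powr_moment:
  fixes X :: "'a \<Rightarrow> 'v::euclidean_space"
  assumes [measurable]: "X \<in> borel_measurable M"
    and K: "(\<integral>\<^sup>+ x. ennreal (norm (X x) powr q) \<partial>M) \<le> ennreal K" and q: "q \<ge> 1" and "K \<ge> 0"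
  shows "integrable M X" and "expectation (\<lambda>x. norm (X x)) \<le> K powr (1 / q)"
proof -
  have I: "integrable M (\<lambda>x. norm (X x) powr q)"
    using K by (intro integrableI_nonneg) (auto intro: le_less_trans)
  have "integrable M (\<lambda>x. 1 + norm (X x) powr q)"
    using I by simp
  then show int: "integrable M X"
  proof (rule Bochner_Integration.integrable_bound, measurable, intro AE_I2)
    fix x
    have "norm (X x) \<le> 1 + norm (X x) powr q"
    proof (cases "norm (X x) \<le> 1")
      case False
      then show ?thesis
        using powr_mono[of 1 q "norm (X x)"] q by simp
    qed (simp add: add_increasing2)
    then show "norm (X x) \<le> norm (1 + norm (X x) powr q)"
      by simp
  qed
  define c where "c = expectation (\<lambda>x. norm (X x))"
  have c: "c \<ge> 0"
    by (simp add: c_def)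
  have "ennreal (c powr q) \<le> ennreal K"
    unfolding c_def using int q by (intro order_trans[OF expectation_powr_le K]) auto
  then have "(c powr q) powr (1 / q) \<le> K powr (1 / q)"
    using q \<open>K \<ge> 0\<close> by (intro powr_mono2) auto
  then show "c \<le> K powr (1 / q)"
    using q c by (simp add: powr_powr)
qed

text \<open>
  Averaging the parallelogram inequality over \<open>a + Y\<close> and \<open>a - Y\<close> and discarding the second
  term by Jensen's inequality replaces the von Bahr--Esseen inequality.
\<close>

lemma (in prob_space) nn_integral_norm_add_centered:
  fixes Y :: "'a \<Rightarrow> 'v::euclidean_space"
  assumes Y: "has_bochner_integral M Y 0" and q: "1 \<le> q" "q \<le> 2"
  shows "(\<integral>\<^sup>+ x. ennreal (norm (a + Y x) powr q) \<partial>M)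
    \<le> ennreal (norm a powr q) + 2 * (\<integral>\<^sup>+ x. ennreal (norm (Y x) powr q) \<partial>M)"
    (is "?A \<le> _ + 2 * ?V")
proof -
  have int: "integrable M Y" "expectation Y = 0"
    using Y by (auto simp: has_bochner_integral_iff)
  then have [measurable]: "Y \<in> borel_measurable M"
    by auto
  have "norm a = norm (expectation (\<lambda>x. a - Y x))"
    using int by (simp add: prob_space)
  also have "\<dots> \<le> expectation (\<lambda>x. norm (a - Y x))"
    by (rule integral_norm_bound)
  finally have "norm a powr q \<le> expectation (\<lambda>x. norm (a - Y x)) powr q"
    using q by (intro powr_mono2) auto
  then have J: "ennreal (norm a powr q) \<le> (\<integral>\<^sup>+ x. ennreal (norm (a - Y x) powr q) \<partial>M)"
    using int q by (intro order_trans[OF ennreal_leI expectation_powr_le]) auto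
  \<comment> \<open>The added term is finite, so it can be cancelled in \<open>ennreal\<close> at
    the end, leaving one of the two copies produced by the parallelogram inequality.\<close>
  have "?A + ennreal (norm a powr q)
      \<le> ?A + (\<integral>\<^sup>+ x. ennreal (norm (a - Y x) powr q) \<partial>M)"
    using J by (rule add_left_mono)
  also have "\<dots> = (\<integral>\<^sup>+ x. ennreal (norm (a + Y x) powr q + norm (a - Y x) powr q) \<partial>M)"
    by (simp add: nn_integral_add)
  also have "\<dots> \<le> (\<integral>\<^sup>+ x. ennreal (2 * norm a powr q + 2 * norm (Y x) powr q) \<partial>M)"
    using q by (intro nn_integral_mono ennreal_leI norm_powr_parallelogram) auto
  also have "\<dots> = (\<integral>\<^sup>+ x. 2 * ennreal (norm a powr q) + 2 * ennreal (norm (Y x) powr q) \<partial>M)"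
    by (simp add: ennreal_mult)
  also have "\<dots> = 2 * ennreal (norm a powr q) + 2 * ?V"
    by (simp add: nn_integral_add nn_integral_cmult emeasure_space_1)
  also have "\<dots> = (ennreal (norm a powr q) + 2 * ?V) + ennreal (norm a powr q)"
    by (simp add: mult_2 ac_simps)
  finally show ?thesis
    by (simp add: ennreal_add_left_cancel_le add.commute[of _ "ennreal (norm a powr q)"])
qed

text \<open>A substitute for conditioning on the past. \<open>X\<close> carries the past and \<xi>
  is a fresh sample; since their joint law is a product, Fubini freezes the state \<open>s\<close>
  and the centered bound applies to the inner integral.\<close>

lemma nn_integral_norm_add_noise:
  fixes a :: "'s \<Rightarrow> 'v::euclidean_space" and h :: "'s \<Rightarrow> 'x \<Rightarrow> 'v"
  assumes D: "prob_space D"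
    and X: "X \<in> measurable P N" and \<xi>: "\<xi> \<in> measurable P D"
    and indep: "distr P (N \<Otimes>\<^sub>M D) (\<lambda>\<omega>. (X \<omega>, \<xi> \<omega>)) = distr P N X \<Otimes>\<^sub>M D"
    and a: "a \<in> borel_measurable N"
    and h: "(\<lambda>(s, x). h s x) \<in> borel_measurable (N \<Otimes>\<^sub>M D)"
    and mean: "\<And>s. s \<in> X ` space P \<Longrightarrow> has_bochner_integral D (h s) 0"
    and bound: "\<And>s. s \<in> X ` space P \<Longrightarrow> (\<integral>\<^sup>+ x. ennreal (norm (h s x) powr q) \<partial>D) \<le> V"
    and P: "prob_space P" and q: "1 \<le> q" "q \<le> 2"
  shows "(\<integral>\<^sup>+ \<omega>. ennreal (norm (a (X \<omega>) + h (X \<omega>) (\<xi> \<omega>)) powr q) \<partial>P)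
    \<le> (\<integral>\<^sup>+ \<omega>. ennreal (norm (a (X \<omega>)) powr q) \<partial>P) + 2 * V"
proof -
  interpret D: prob_space D by fact
  interpret P: prob_space P by fact
  note [measurable] = X \<xi> a h
  have "(\<integral>\<^sup>+ \<omega>. ennreal (norm (a (X \<omega>) + h (X \<omega>) (\<xi> \<omega>)) powr q) \<partial>P)
      = (\<integral>\<^sup>+ z. ennreal (norm (a (fst z) + (\<lambda>(s, x). h s x) z) powr q)
          \<partial>distr P (N \<Otimes>\<^sub>M D) (\<lambda>\<omega>. (X \<omega>, \<xi> \<omega>)))"
    by (subst nn_integral_distr) auto
  also have "\<dots> = (\<integral>\<^sup>+ s. (\<integral>\<^sup>+ x. ennreal (norm (a s + h s x) powr q) \<partial>D) \<partial>distr P N X)"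
    unfolding indep by (subst D.nn_integral_fst[symmetric]) auto
  \<comment> \<open>The outer integral returns to \<open>P\<close> because centering and the moment
    bound are assumed only at states attained by \<open>X\<close>.\<close>
  also have "\<dots> = (\<integral>\<^sup>+ \<omega>. (\<integral>\<^sup>+ x. ennreal (norm (a (X \<omega>) + h (X \<omega>) x) powr q) \<partial>D) \<partial>P)"
    by (subst nn_integral_distr) auto
  also have "\<dots> \<le> (\<integral>\<^sup>+ \<omega>. ennreal (norm (a (X \<omega>)) powr q) + 2 * V \<partial>P)"
    using mean bound q
    by (intro nn_integral_mono order_trans[OF D.nn_integral_norm_add_centered] add_left_mono mult_left_mono)
       auto
  also have "\<dots> = (\<integral>\<^sup>+ \<omega>. ennreal (norm (a (X \<omega>)) powr q) \<partial>P) + 2 * V"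
    by (subst nn_integral_add) (auto simp: P.emeasure_space_1)
  finally show ?thesis .
qed

section \<open>Adapted processes and independence of the next sample\<close>

text \<open>Measurability with respect to the first \<open>t\<close> samples is encoded as a
  factorization through their tuple, in the style of Doob and Dynkin. The identity is required on
  \<open>space P\<close> only, since the trajectories are specified only there. For
  \<open>t = 0\<close> the tuple is empty and \<open>X\<close> is constant on
  \<open>space P\<close>.\<close>

definition adapted ::
  "'o measure \<Rightarrow> 'x measure \<Rightarrow> (nat \<Rightarrow> 'o \<Rightarrow> 'x) \<Rightarrow> nat \<Rightarrow> 's measure \<Rightarrow> ('o \<Rightarrow> 's) \<Rightarrow> bool" where
  "adapted P D \<xi> t N X \<longleftrightarrow>
     (\<exists>H \<in> measurable (PiM {1..t} (\<lambda>_. D)) N. \<forall>\<omega>\<in>space P. X \<omega> = H (\<lambda>i\<in>{1..t}. \<xi> i \<omega>))"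

lemma adapted_const: "c \<in> space N \<Longrightarrow> adapted P D \<xi> t N (\<lambda>_. c)"
  unfolding adapted_def by (intro bexI[of _ "\<lambda>_. c"]) auto

lemma adapted_Suc:
  assumes "adapted P D \<xi> t N X" and \<Phi>: "\<Phi> \<in> measurable (N \<Otimes>\<^sub>M D) N'"
    and X': "\<And>\<omega>. \<omega> \<in> space P \<Longrightarrow> X' \<omega> = \<Phi> (X \<omega>, \<xi> (Suc t) \<omega>)"
  shows "adapted P D \<xi> (Suc t) N' X'"
proof -
  obtain H where H: "H \<in> measurable (PiM {1..t} (\<lambda>_. D)) N"
    and XH: "\<forall>\<omega>\<in>space P. X \<omega> = H (\<lambda>i\<in>{1..t}. \<xi> i \<omega>)"
    using assms(1) unfolding adapted_def by blast
  have "(\<lambda>x. restrict x {1..t}) \<in> measurable (PiM {1..Suc t} (\<lambda>_. D)) (PiM {1..t} (\<lambda>_. D))"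
    by (intro measurable_restrict_subset) auto
  then have "(\<lambda>x. (H (restrict x {1..t}), x (Suc t))) \<in> measurable (PiM {1..Suc t} (\<lambda>_. D)) (N \<Otimes>\<^sub>M D)"
    by (intro measurable_Pair measurable_compose[OF _ H] measurable_component_singleton) auto
  then have "(\<lambda>x. \<Phi> (H (restrict x {1..t}), x (Suc t))) \<in> measurable (PiM {1..Suc t} (\<lambda>_. D)) N'"
    by (rule measurable_compose[OF _ \<Phi>])
  moreover have "X' \<omega> = \<Phi> (H (restrict (\<lambda>i\<in>{1..Suc t}. \<xi> i \<omega>) {1..t}), (\<lambda>i\<in>{1..Suc t}. \<xi> i \<omega>) (Suc t))"
    if "\<omega> \<in> space P" for \<omega>
  proof -
    have "restrict (\<lambda>i\<in>{1..Suc t}. \<xi> i \<omega>) {1..t} = (\<lambda>i\<in>{1..t}. \<xi> i \<omega>)"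
      by (auto simp: restrict_def fun_eq_iff)
    then show ?thesis
      using that X' XH by simp
  qed
  ultimately show ?thesis
    unfolding adapted_def by (intro bexI[where x="\<lambda>x. \<Phi> (H (restrict x {1..t}), x (Suc t))"]) blast
qed

lemma iid_samples_measurable:
  assumes "iid_samples P D \<xi>" "t \<ge> 1"
  shows "\<xi> t \<in> measurable P D"
proof -
  interpret P: prob_space P
    using assms by (simp add: iid_samples_def)
  show ?thesis
    using assms by (auto simp: iid_samples_def P.indep_vars_def2)
qed

lemma adapted_measurable:
  assumes "adapted P D \<xi> t N X" "iid_samples P D \<xi>"
  shows "X \<in> measurable P N"
proof -
  obtain H where H: "H \<in> measurable (PiM {1..t} (\<lambda>_. D)) N"
    and XH: "\<forall>\<omega>\<in>space P. X \<omega> = H (\<lambda>i\<in>{1..t}. \<xi> i \<omega>)"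
    using assms(1) unfolding adapted_def by blast
  have "(\<lambda>\<omega>. \<lambda>i\<in>{1..t}. \<xi> i \<omega>) \<in> measurable P (PiM {1..t} (\<lambda>_. D))"
    using iid_samples_measurable[OF assms(2)] by (intro measurable_restrict) auto
  then have "(\<lambda>\<omega>. H (\<lambda>i\<in>{1..t}. \<xi> i \<omega>)) \<in> measurable P N"
    by (rule measurable_compose[OF _ H])
  then show ?thesis
    using XH by (subst measurable_cong[of P X]) auto
qed

text \<open>The index blocks \<open>{1..t}\<close> and \<open>{Suc t}\<close> are disjoint, so their
  sample tuples are independent. \<open>X\<close> is an image of the first tuple and the new sample
  is a coordinate of the second; a product map sends the product law to the product of the image
  laws.\<close>

lemma adapted_indep:
  assumes ad: "adapted P D \<xi> t N X" and iid: "iid_samples P D \<xi>"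
  shows "distr P (N \<Otimes>\<^sub>M D) (\<lambda>\<omega>. (X \<omega>, \<xi> (Suc t) \<omega>)) = distr P N X \<Otimes>\<^sub>M D"
proof -
  interpret P: prob_space P
    using iid by (simp add: iid_samples_def)
  obtain H where H: "H \<in> measurable (PiM {1..t} (\<lambda>_. D)) N"
    and XH: "\<forall>\<omega>\<in>space P. X \<omega> = H (\<lambda>i\<in>{1..t}. \<xi> i \<omega>)"
    using ad unfolding adapted_def by blast
  define past where "past \<omega> = (\<lambda>i\<in>{1..t}. \<xi> i \<omega>)" for \<omega>
  define new where "new \<omega> = (\<lambda>i\<in>{Suc t}. \<xi> i \<omega>)" for \<omega>
  let ?M = "PiM {1..t} (\<lambda>_. D)" and ?M' = "PiM {Suc t} (\<lambda>_. D)"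
  have X: "X \<omega> = H (past \<omega>)" if "\<omega> \<in> space P" for \<omega>
    using XH that by (simp add: past_def)
  have \<xi>: "\<xi> (Suc t) \<omega> = new \<omega> (Suc t)" for \<omega>
    by (simp add: new_def)
  have "P.indep_var ?M past ?M' new"
    unfolding past_def new_def
    using iid by (intro P.indep_var_restrict[where I="{1..}"]) (auto simp: iid_samples_def)
  then have past [measurable]: "past \<in> measurable P ?M" and new [measurable]: "new \<in> measurable P ?M'"
    and prod: "distr P ?M past \<Otimes>\<^sub>M distr P ?M' new = distr P (?M \<Otimes>\<^sub>M ?M') (\<lambda>\<omega>. (past \<omega>, new \<omega>))"
    unfolding P.indep_var_distribution_eq by auto
  note [measurable] = H
  have proj [measurable]: "(\<lambda>x. x (Suc t)) \<in> measurable ?M' D"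
    by (rule measurable_component_singleton) simp
  have "distr P N X = distr (distr P ?M past) N H"
    using X by (subst distr_distr[OF H past]) (auto intro!: distr_cong)
  moreover have D: "D = distr (distr P ?M' new) D (\<lambda>x. x (Suc t))"
  proof -
    have "D = distr P D (\<xi> (Suc t))"
      using iid by (simp add: iid_samples_def)
    also have "\<dots> = distr (distr P ?M' new) D (\<lambda>x. x (Suc t))"
      using \<xi> by (subst distr_distr[OF proj new]) (auto intro!: distr_cong)
    finally show ?thesis .
  qed
  moreover have "distr (distr P ?M past) N H \<Otimes>\<^sub>M distr (distr P ?M' new) D (\<lambda>x. x (Suc t))
      = distr (distr P ?M past \<Otimes>\<^sub>M distr P ?M' new) (N \<Otimes>\<^sub>M D) (\<lambda>(x, y). (H x, y (Suc t)))"
  proof (rule pair_measure_distr)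
    interpret new: prob_space "distr P ?M' new"
      by (rule P.prob_space_distr) measurable
    show "sigma_finite_measure (distr (distr P ?M' new) D (\<lambda>x. x (Suc t)))"
      by (intro prob_space_imp_sigma_finite new.prob_space_distr) (simp del: One_nat_def)
  qed (simp_all del: One_nat_def)
  moreover have "\<dots> = distr P (N \<Otimes>\<^sub>M D) (\<lambda>\<omega>. (X \<omega>, \<xi> (Suc t) \<omega>))"
    unfolding prod using X \<xi> by (subst distr_distr) (auto intro!: distr_cong simp del: One_nat_def)
  ultimately show ?thesis
    by simp
qed

section \<open>Discounted sums of martingale differences\<close>

text \<open>Since \<open>q\<close> is at least 1, \<theta> to the power \<open>q\<close> is at most
  \<theta>. One step therefore maps a bound \<open>M\<close> on the \<open>q\<close>-th moment to
  \<open>\<theta> * M + 2 * V\<close>. The fixed point \<open>K\<close> of this map bounds the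
  moment at all times, as the process starts at 0.\<close>

lemma discounted_noise_moment:
  fixes X :: "nat \<Rightarrow> 'o \<Rightarrow> 's" and u :: "'s \<Rightarrow> 'v::euclidean_space" and h :: "'s \<Rightarrow> 'x \<Rightarrow> 'v"
  assumes D: "prob_space D" and iid: "iid_samples P D \<xi>"
    and ad: "\<And>t. adapted P D \<xi> t N (X t)"
    and u [measurable]: "u \<in> borel_measurable N"
    and h: "(\<lambda>(s, x). h s x) \<in> borel_measurable (N \<Otimes>\<^sub>M D)"
    and mean: "\<And>t \<omega>. \<omega> \<in> space P \<Longrightarrow> has_bochner_integral D (h (X t \<omega>)) 0"
    and bound: "\<And>t \<omega>. \<omega> \<in> space P \<Longrightarrow>
      (\<integral>\<^sup>+ x. ennreal (norm (h (X t \<omega>) x) powr q) \<partial>D) \<le> ennreal V"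
    and u0: "\<And>\<omega>. \<omega> \<in> space P \<Longrightarrow> u (X 0 \<omega>) = 0"
    and rec: "\<And>t \<omega>. \<omega> \<in> space P \<Longrightarrow>
      u (X (Suc t) \<omega>) = \<theta> *\<^sub>R u (X t \<omega>) + h (X t \<omega>) (\<xi> (Suc t) \<omega>)"
    and q: "1 \<le> q" "q \<le> 2" and \<theta>: "0 \<le> \<theta>" "\<theta> < 1" and V: "V \<ge> 0"
  shows "integrable P (\<lambda>\<omega>. u (X t \<omega>))"
    and "(\<integral>\<omega>. norm (u (X t \<omega>)) \<partial>P) \<le> (2 * V / (1 - \<theta>)) powr (1 / q)"
proof -
  interpret P: prob_space P
    using iid by (simp add: iid_samples_def)
  have [measurable]: "X t \<in> measurable P N" for t
    by (rule adapted_measurable[OF ad iid])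
  define K where "K = 2 * V / (1 - \<theta>)"
  have K: "K \<ge> 0" "\<theta> * K + 2 * V = K"
    using \<theta> V by (auto simp: K_def field_simps)
  have M: "(\<integral>\<^sup>+ \<omega>. ennreal (norm (u (X t \<omega>)) powr q) \<partial>P) \<le> ennreal K" for t
  proof (induction t)
    case 0
    have "(\<integral>\<^sup>+ \<omega>. ennreal (norm (u (X 0 \<omega>)) powr q) \<partial>P) = (\<integral>\<^sup>+ \<omega>. 0 \<partial>P)"
      by (intro nn_integral_cong) (simp add: u0)
    then show ?case
      by simp
  next
    case (Suc t)
    have "(\<integral>\<^sup>+ \<omega>. ennreal (norm (u (X (Suc t) \<omega>)) powr q) \<partial>P)
        = (\<integral>\<^sup>+ \<omega>. ennreal (norm (\<theta> *\<^sub>R u (X t \<omega>) + h (X t \<omega>) (\<xi> (Suc t) \<omega>)) powr q) \<partial>P)"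
      by (intro nn_integral_cong) (simp add: rec)
    also have "\<dots> \<le> (\<integral>\<^sup>+ \<omega>. ennreal (norm (\<theta> *\<^sub>R u (X t \<omega>)) powr q) \<partial>P) + 2 * ennreal V"
      using mean bound q
      by (intro nn_integral_norm_add_noise[where N=N and D=D] D h P.prob_space_axioms
            adapted_indep[OF ad iid] iid_samples_measurable[OF iid]) auto
    also have "(\<integral>\<^sup>+ \<omega>. ennreal (norm (\<theta> *\<^sub>R u (X t \<omega>)) powr q) \<partial>P)
        \<le> (\<integral>\<^sup>+ \<omega>. ennreal \<theta> * ennreal (norm (u (X t \<omega>)) powr q) \<partial>P)"
    proof (intro nn_integral_mono)
      fix \<omega>
      have "\<theta> powr q \<le> \<theta>"
        using powr_mono'[of 1 q \<theta>] \<theta> q by simp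
      then have "norm (\<theta> *\<^sub>R u (X t \<omega>)) powr q \<le> \<theta> * norm (u (X t \<omega>)) powr q"
        using \<theta> by (simp add: powr_mult mult_right_mono)
      then show "ennreal (norm (\<theta> *\<^sub>R u (X t \<omega>)) powr q) \<le> ennreal \<theta> * ennreal (norm (u (X t \<omega>)) powr q)"
        using \<theta> by (simp add: ennreal_mult[symmetric] ennreal_leI)
    qed
    also have "\<dots> \<le> ennreal \<theta> * ennreal K"
      using Suc by (simp add: nn_integral_cmult mult_left_mono)
    also have "ennreal \<theta> * ennreal K + 2 * ennreal V = ennreal (\<theta> * K + 2 * V)"
      using \<theta> V K(1) by (simp add: ennreal_mult)
    finally show ?case
      by (simp add: K)
  qed
  show "integrable P (\<lambda>\<omega>. u (X t \<omega>))"
    using M q K by (intro P.integrable_powr_moment(1)[where q=q and K=K]) auto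
  show "(\<integral>\<omega>. norm (u (X t \<omega>)) \<partial>P) \<le> (2 * V / (1 - \<theta>)) powr (1 / q)"
    unfolding K_def[symmetric]
    using M q K by (intro P.integrable_powr_moment(2)[where q=q and K=K]) auto
qed

section \<open>Descent of a smooth function along a normalised step\<close>

lemma descent_lemma:
  fixes F :: "'v::euclidean_space \<Rightarrow> real" and x d :: 'v
  assumes diff: "\<And>v. F differentiable (at v)"
    and Lip: "\<And>x y. norm (gradient F y - gradient F x) \<le> L * norm (y - x)"
  shows "F (x + d) \<le> F x + gradient F x \<bullet> d + L / 2 * (norm d)\<^sup>2"
proof -
  \<comment> \<open>The claim reads \<open>\<psi> 1 \<le> \<psi> 0\<close>. By the Lipschitz bound
    the derivative of \<psi> is nonpositive on [0,1], so no integral along the segment is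
    needed.\<close>
  define \<psi> where "\<psi> s = F (x + s *\<^sub>R d) - s * (gradient F x \<bullet> d) - L / 2 * (norm d)\<^sup>2 * s\<^sup>2" for s :: real
  have "\<psi> 1 \<le> \<psi> 0"
  proof (rule DERIV_nonpos_imp_nonincreasing[where f=\<psi> and a=0 and b=1])
    fix s :: real
    assume s: "0 \<le> s" "s \<le> 1"
    have "(F has_derivative (\<lambda>h. h \<bullet> gradient F (x + s *\<^sub>R d))) (at (x + s *\<^sub>R d))"
      using GDERIV_gradient[OF diff] by (simp add: gderiv_def)
    then have "((\<lambda>s. F (x + s *\<^sub>R d)) has_derivative (\<lambda>h. (h *\<^sub>R d) \<bullet> gradient F (x + s *\<^sub>R d))) (at s)"
      by (rule has_derivative_compose[rotated]) (auto intro!: derivative_eq_intros)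
    moreover have "(\<lambda>h. (h *\<^sub>R d) \<bullet> gradient F (x + s *\<^sub>R d)) = (*) (gradient F (x + s *\<^sub>R d) \<bullet> d)"
      by (simp add: fun_eq_iff inner_commute)
    ultimately have "((\<lambda>s. F (x + s *\<^sub>R d)) has_real_derivative (gradient F (x + s *\<^sub>R d) \<bullet> d)) (at s)"
      by (simp only: has_field_derivative_def)
    then have D: "(\<psi> has_real_derivative
        (gradient F (x + s *\<^sub>R d) \<bullet> d - gradient F x \<bullet> d - L / 2 * (norm d)\<^sup>2 * (2 * s))) (at s)"
      unfolding \<psi>_def by (auto intro!: derivative_eq_intros)
    have "(gradient F (x + s *\<^sub>R d) - gradient F x) \<bullet> d \<le> norm (gradient F (x + s *\<^sub>R d) - gradient F x) * norm d"
      by (rule norm_cauchy_schwarz)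
    also have "\<dots> \<le> L * norm (s *\<^sub>R d) * norm d"
      using Lip[of "x + s *\<^sub>R d" x] by (intro mult_right_mono) auto
    also have "\<dots> = L / 2 * (norm d)\<^sup>2 * (2 * s)"
      using s by (simp add: power2_eq_square)
    finally show "\<exists>y. (\<psi> has_real_derivative y) (at s) \<and> y \<le> 0"
      using D by (intro exI conjI) (auto simp: inner_diff_left)
  qed simp
  then show ?thesis
    by (simp add: \<psi>_def)
qed

text \<open>The inner product of \<open>m\<close> with \<open>sgn m\<close> is
  \<open>norm m\<close>, hence that of the gradient with \<open>sgn m\<close> is at least
  \<open>norm m\<close> minus the error. The triangle inequality costs a second copy of the error,
  whence the factor 2. The argument includes \<open>m = 0\<close>, where
  \<open>sgn m = 0\<close>.\<close>

lemma normalized_step_descent: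
  fixes F :: "'v::euclidean_space \<Rightarrow> real" and x d m :: 'v
  assumes diff: "\<And>v. F differentiable (at v)"
    and Lip: "\<And>x y. norm (gradient F y - gradient F x) \<le> L * norm (y - x)"
    and "L \<ge> 0" "\<gamma> \<ge> 0"
  shows "F (x - \<gamma> *\<^sub>R sgn m)
    \<le> F x - \<gamma> * norm (gradient F x) + 2 * \<gamma> * norm (m - gradient F x) + L / 2 * \<gamma>\<^sup>2"
proof -
  let ?g = "gradient F x"
  have "norm ?g - 2 * norm (m - ?g) \<le> norm m - norm (m - ?g)"
    using norm_triangle_ineq4[of m "m - ?g"] by simp
  also have "\<dots> \<le> m \<bullet> sgn m - (m - ?g) \<bullet> sgn m"
  proof -
    have "m \<bullet> sgn m = norm m"
      by (simp add: sgn_div_norm power2_norm_eq_inner[symmetric] power2_eq_square field_simps)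
    moreover have "(m - ?g) \<bullet> sgn m \<le> norm (m - ?g) * norm (sgn m)"
      by (rule norm_cauchy_schwarz)
    moreover have "\<dots> \<le> norm (m - ?g)"
      by (simp add: norm_sgn)
    ultimately show ?thesis
      by linarith
  qed
  also have "\<dots> = ?g \<bullet> sgn m"
    by (simp add: inner_diff_left)
  finally have 1: "\<gamma> * (norm ?g - 2 * norm (m - ?g)) \<le> \<gamma> * (?g \<bullet> sgn m)"
    using \<open>\<gamma> \<ge> 0\<close> by (rule mult_left_mono)
  have "(norm (\<gamma> *\<^sub>R sgn m))\<^sup>2 \<le> \<gamma>\<^sup>2"
    using \<open>\<gamma> \<ge> 0\<close> by (intro power_mono) (auto simp: norm_sgn)
  then have 2: "L / 2 * (norm (\<gamma> *\<^sub>R sgn m))\<^sup>2 \<le> L / 2 * \<gamma>\<^sup>2"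
    using \<open>L \<ge> 0\<close> by (intro mult_left_mono) auto
  have "F (x - \<gamma> *\<^sub>R sgn m) \<le> F x - \<gamma> * (?g \<bullet> sgn m) + L / 2 * (norm (\<gamma> *\<^sub>R sgn m))\<^sup>2"
    using descent_lemma[OF diff Lip, of x "- \<gamma> *\<^sub>R sgn m"] by simp
  with 1 2 show ?thesis
    by (simp add: algebra_simps)
qed

section \<open>The averaged gradient bound for arbitrary parameters\<close>

text \<open>The terms on the right come, in order, from the telescoped objective, the bias of
  starting the momentum at 0, the noise sum \<open>u\<close>, the difference sum \<open>z\<close>,
  and the quadratic term of the descent inequality.\<close>

lemma NSGD_VR_average_gradient:
  fixes D :: "'x measure" and f :: "'v::euclidean_space \<Rightarrow> 'x \<Rightarrow> real" and w m :: "nat \<Rightarrow> 'o \<Rightarrow> 'v"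
  defines "F \<equiv> objective D f"
  assumes obj: "stochastic_objective D f" and bdd: "bdd_below (range F)"
    and noise: "heavy_tailed_noise D f \<sigma> p" and lip: "individual_Lipschitz D f w0 L B"
    and iid: "iid_samples P D \<xi>"
    and alg: "\<And>\<omega>. \<omega> \<in> space P \<Longrightarrow> NSGD_VR f \<gamma> \<theta> w0 (\<lambda>t. \<xi> t \<omega>) (\<lambda>t. w t \<omega>) (\<lambda>t. m t \<omega>)"
    and \<theta>: "0 \<le> \<theta>" "\<theta> < 1" and \<gamma>: "\<gamma> > 0"
  shows "(\<Sum>t = 1..T. \<integral>\<omega>. norm (gradient F (w t \<omega>)) \<partial>P)
    \<le> (F w0 - (INF v. F v)) / \<gamma> + 2 * norm (gradient F w0) * (\<Sum>t = 1..T. \<theta> ^ t)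
      + real T * (4 * (1 - \<theta>) powr ((p - 1) / p) * \<sigma>
          + 2 * sqrt 8 * \<theta> * L * \<gamma> / sqrt (1 - \<theta>) + L * \<gamma> / 2)"
proof -
  interpret P: prob_space P
    using iid by (simp add: iid_samples_def)
  interpret D: prob_space D
    using obj by (simp add: stochastic_objective_def)
  define G where "G = (\<lambda>v x. gradient (\<lambda>v. f v x) v)"
  define g where "g = gradient F"
  have L: "L > 0"
    using lip by (simp add: individual_Lipschitz_def)
  have \<sigma>: "\<sigma> > 0" and p: "1 < p" "p \<le> 2"
    using noise by (auto simp: heavy_tailed_noise_def)
  have G_lip: "norm (G y x - G v x) \<le> L * norm (y - v)" if "x \<in> space D" for v x y
    using lip that by (auto simp: individual_Lipschitz_def G_def)
  have G_mean: "integrable D (G v)" "(\<integral>x. G v x \<partial>D) = g v" for v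
    using lip by (auto simp: individual_Lipschitz_def G_def g_def F_def has_bochner_integral_iff)
  have g_lip: "norm (g y - g v) \<le> L * norm (y - v)" for y v
  proof -
    have "norm (g y - g v) = norm (\<integral>x. G y x - G v x \<partial>D)"
      by (simp add: G_mean)
    also have "\<dots> \<le> (\<integral>x. norm (G y x - G v x) \<partial>D)"
      by (rule integral_norm_bound)
    also have "\<dots> \<le> (\<integral>x. L * norm (y - v) \<partial>D)"
      by (intro integral_mono) (auto simp: G_mean G_lip)
    finally show ?thesis
      by (simp add: D.prob_space)
  qed
  have cont: "continuous_on UNIV k" if "\<And>y v. norm (k y - k v) \<le> L * norm (y - v)" for k :: "'v \<Rightarrow> 'v"
    using that L by (intro lipschitz_on_continuous_on[of L] lipschitz_onI) (auto simp: dist_norm)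
  have [measurable]: "g \<in> borel_measurable borel"
    by (intro borel_measurable_continuous_onI cont g_lip)
  have [measurable]: "G v \<in> borel_measurable D" for v
    using G_mean(1) by (rule borel_measurable_integrable)
  have G_joint: "(\<lambda>(v, x). G v x) \<in> borel_measurable (borel \<Otimes>\<^sub>M D)"
    by (intro measurable_Caratheodory cont G_lip) auto

  have w0: "w 0 \<omega> = w0" "w (Suc 0) \<omega> = w0" "m 0 \<omega> = 0"
    and m_Suc: "m (Suc t) \<omega> = \<theta> *\<^sub>R m t \<omega> + G (w (Suc t) \<omega>) (\<xi> (Suc t) \<omega>) - \<theta> *\<^sub>R G (w t \<omega>) (\<xi> (Suc t) \<omega>)"
    and w_Suc: "w (Suc (Suc t)) \<omega> = w (Suc t) \<omega> - \<gamma> *\<^sub>R sgn (m (Suc t) \<omega>)"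
    if "\<omega> \<in> space P" for t \<omega>
    using alg[OF that] by (auto simp: NSGD_VR_def G_def)
  \<comment> \<open>For \<open>t = 0\<close> the displacement is zero, because the initial point is
    repeated; every later one is \<gamma> times a vector of norm at most 1.\<close>
  have step: "norm (w (Suc t) \<omega> - w t \<omega>) \<le> \<gamma>" if "\<omega> \<in> space P" for t \<omega>
    using that \<gamma> by (cases t) (auto simp: w0 w_Suc norm_sgn)

  \<comment> \<open>\<open>hu\<close> and \<open>hz\<close> are the increments of \<open>u\<close>
    and \<open>z\<close> as functions of the state and the fresh sample: \<open>wp\<close> and
    \<open>wc\<close> are the previous and the current iterate at which that sample is
    evaluated.\<close>
  define hu :: "'v \<times> 'v \<times> 'v \<times> 'v \<times> 'v \<Rightarrow> 'x \<Rightarrow> 'v"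
    where "hu = (\<lambda>(wp, wc, _) x. (1 - \<theta>) *\<^sub>R (G wc x - g wc))"
  define hz :: "'v \<times> 'v \<times> 'v \<times> 'v \<times> 'v \<Rightarrow> 'x \<Rightarrow> 'v"
    where "hz = (\<lambda>(wp, wc, _) x. \<theta> *\<^sub>R (G wc x - G wp x - (g wc - g wp)))"
  define u where "u t \<omega> = rec_nat 0 (\<lambda>t r. \<theta> *\<^sub>R r +
      (1 - \<theta>) *\<^sub>R (G (w (Suc t) \<omega>) (\<xi> (Suc t) \<omega>) - g (w (Suc t) \<omega>))) t" for t \<omega>
  define z where "z t \<omega> = rec_nat 0 (\<lambda>t r. \<theta> *\<^sub>R r +
      \<theta> *\<^sub>R (G (w (Suc t) \<omega>) (\<xi> (Suc t) \<omega>) - G (w t \<omega>) (\<xi> (Suc t) \<omega>)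
        - (g (w (Suc t) \<omega>) - g (w t \<omega>)))) t" for t \<omega>
  \<comment> \<open>The state at time \<open>t\<close> contains \<open>w (Suc t)\<close>, which is
    already determined by the first \<open>t\<close> samples. This shift makes sample
    \<open>Suc t\<close> independent of the point where its gradient is taken.\<close>
  define X where "X t \<omega> = (w t \<omega>, w (Suc t) \<omega>, m t \<omega>, u t \<omega>, z t \<omega>)" for t \<omega>
  define N :: "('v \<times> 'v \<times> 'v \<times> 'v \<times> 'v) measure"
    where "N = borel \<Otimes>\<^sub>M (borel \<Otimes>\<^sub>M (borel \<Otimes>\<^sub>M (borel \<Otimes>\<^sub>M borel)))"

  \<comment> \<open>Joint measurability of \<open>G\<close> in the form applicable to any measurable
    component of the state.\<close>
  have [measurable]: "(\<lambda>q. G (a q) (snd q)) \<in> borel_measurable (N \<Otimes>\<^sub>M D)"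
    if [measurable]: "a \<in> borel_measurable (N \<Otimes>\<^sub>M D)" for a
    using measurable_compose[OF _ G_joint, of "\<lambda>q. (a q, snd q)" "N \<Otimes>\<^sub>M D"] by simp
  have N_proj [measurable]:
    "(\<lambda>s. fst s) \<in> borel_measurable N" "(\<lambda>s. fst (snd s)) \<in> borel_measurable N"
    "(\<lambda>s. fst (snd (snd s))) \<in> borel_measurable N" "(\<lambda>s. fst (snd (snd (snd s)))) \<in> borel_measurable N"
    "(\<lambda>s. snd (snd (snd (snd s)))) \<in> borel_measurable N"
    unfolding N_def by measurable
  have hu_meas: "(\<lambda>(s, x). hu s x) \<in> borel_measurable (N \<Otimes>\<^sub>M D)"
    and hz_meas: "(\<lambda>(s, x). hz s x) \<in> borel_measurable (N \<Otimes>\<^sub>M D)"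
    unfolding hu_def hz_def split_beta' by measurable

  \<comment> \<open>The transition map of the state, with \<open>sgn m'\<close> written out as a
    quotient.\<close>
  define \<Phi> where "\<Phi> q = (let s = fst q; x = snd q; wp = fst s; wc = fst (snd s);
      m' = \<theta> *\<^sub>R fst (snd (snd s)) + G wc x - \<theta> *\<^sub>R G wp x
    in (wc, wc - \<gamma> *\<^sub>R (m' /\<^sub>R norm m'), m',
        \<theta> *\<^sub>R fst (snd (snd (snd s))) + (1 - \<theta>) *\<^sub>R (G wc x - g wc),
        \<theta> *\<^sub>R snd (snd (snd (snd s))) + \<theta> *\<^sub>R (G wc x - G wp x - (g wc - g wp))))"
    for q :: "('v \<times> 'v \<times> 'v \<times> 'v \<times> 'v) \<times> 'x"
  have \<Phi>: "\<Phi> \<in> measurable (N \<Otimes>\<^sub>M D) N"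
  proof -
    have "\<Phi> \<in> measurable (N \<Otimes>\<^sub>M D) (borel \<Otimes>\<^sub>M (borel \<Otimes>\<^sub>M (borel \<Otimes>\<^sub>M (borel \<Otimes>\<^sub>M borel))))"
      unfolding \<Phi>_def Let_def by measurable
    then show ?thesis
      by (simp add: N_def)
  qed
  have ad: "adapted P D \<xi> t N (X t)" for t
  proof (induction t)
    case 0
    have "adapted P D \<xi> 0 N (\<lambda>_. (w0, w0, 0, 0, 0))"
      by (rule adapted_const) (simp add: N_def space_pair_measure)
    then show ?case
      by (simp add: adapted_def X_def w0 u_def z_def)
  next
    case (Suc t)
    then show ?case
      by (rule adapted_Suc[OF _ \<Phi>])
        (simp add: X_def \<Phi>_def Let_def m_Suc w_Suc u_def z_def sgn_div_norm)
  qed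
  have X_meas [measurable]: "X t \<in> measurable P N" for t
    by (rule adapted_measurable[OF ad iid])
  have w_meas [measurable]: "w t \<in> borel_measurable P" for t
    using measurable_compose[OF X_meas N_proj(1)] by (simp add: X_def)

  have u_int: "integrable P (u t)"
    and u_bound: "(\<integral>\<omega>. norm (u t \<omega>) \<partial>P) \<le> (2 * ((1 - \<theta>) * \<sigma>) powr p / (1 - \<theta>)) powr (1 / p)" for t
  proof -
    have mean: "has_bochner_integral D (hu (X t \<omega>)) 0" for t \<omega>
      unfolding has_bochner_integral_iff by (simp add: hu_def X_def G_mean D.prob_space)
    have bound: "(\<integral>\<^sup>+ x. ennreal (norm (hu (X t \<omega>) x) powr p) \<partial>D) \<le> ennreal (((1 - \<theta>) * \<sigma>) powr p)" for t \<omega>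
    proof -
      define v where "v = w (Suc t) \<omega>"
      have "(\<integral>\<^sup>+ x. ennreal (norm (hu (X t \<omega>) x) powr p) \<partial>D)
          = (\<integral>\<^sup>+ x. ennreal ((1 - \<theta>) powr p) * ennreal (norm (G v x - g v) powr p) \<partial>D)"
        using \<theta> by (simp add: hu_def X_def v_def powr_mult ennreal_mult)
      also have "\<dots> = ennreal ((1 - \<theta>) powr p) * (\<integral>\<^sup>+ x. ennreal (norm (G v x - g v) powr p) \<partial>D)"
        by (simp add: nn_integral_cmult)
      also have "(\<integral>\<^sup>+ x. ennreal (norm (G v x - g v) powr p) \<partial>D) \<le> ennreal (\<sigma> powr p)"
        using noise unfolding heavy_tailed_noise_def G_def g_def F_def
        by (metis (no_types, lifting) SUP_upper UNIV_I order_trans)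
      also have "ennreal ((1 - \<theta>) powr p) * ennreal (\<sigma> powr p) = ennreal (((1 - \<theta>) * \<sigma>) powr p)"
        using \<theta> \<sigma> by (simp add: powr_mult ennreal_mult)
      finally show ?thesis
        by (simp add: mult_left_mono)
    qed
    note * = discounted_noise_moment[OF D.prob_space_axioms iid ad N_proj(4) hu_meas mean bound,
      where \<theta>=\<theta> and t=t, simplified X_def fst_conv snd_conv]
    show "integrable P (u t)"
      by (rule *(1)) (use p \<theta> in \<open>auto simp: u_def hu_def\<close>)
    show "(\<integral>\<omega>. norm (u t \<omega>) \<partial>P) \<le> (2 * ((1 - \<theta>) * \<sigma>) powr p / (1 - \<theta>)) powr (1 / p)"
      by (rule *(2)) (use p \<theta> in \<open>auto simp: u_def hu_def\<close>)
  qed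
  have z_int: "integrable P (z t)"
    and z_bound: "(\<integral>\<omega>. norm (z t \<omega>) \<partial>P) \<le> (2 * (2 * \<theta> * L * \<gamma>)\<^sup>2 / (1 - \<theta>)) powr (1 / 2)" for t
  proof -
    have mean: "has_bochner_integral D (hz (X t \<omega>)) 0" for t \<omega>
      unfolding has_bochner_integral_iff by (simp add: hz_def X_def G_mean D.prob_space)
    \<comment> \<open>The difference noise is bounded uniformly, not just in a moment: both
      gradients are Lipschitz and consecutive iterates on a trajectory are at most \<gamma> apart.
      This gives a second moment bound for every \<open>p\<close>.\<close>
    have bound: "(\<integral>\<^sup>+ x. ennreal (norm (hz (X t \<omega>) x) powr 2) \<partial>D) \<le> ennreal ((2 * \<theta> * L * \<gamma>)\<^sup>2)"
      if "\<omega> \<in> space P" for t \<omega>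
    proof -
      have "norm (hz (X t \<omega>) x) powr 2 \<le> (2 * \<theta> * L * \<gamma>)\<^sup>2" if "x \<in> space D" for x
      proof -
        define v y where "v = w t \<omega>" and "y = w (Suc t) \<omega>"
        have "norm (G y x - G v x - (g y - g v)) \<le> norm (G y x - G v x) + norm (g y - g v)"
          by (rule norm_triangle_ineq4)
        also have "\<dots> \<le> 2 * (L * norm (y - v))"
          using G_lip[OF that, of y v] g_lip[of y v] by simp
        also have "\<dots> \<le> 2 * (L * \<gamma>)"
          using step[OF \<open>\<omega> \<in> space P\<close>, of t] L by (simp add: v_def y_def)
        finally have "norm (hz (X t \<omega>) x) \<le> 2 * \<theta> * L * \<gamma>"
          using \<theta> mult_left_mono[of _ "2 * (L * \<gamma>)" \<theta>]
          by (simp add: hz_def X_def v_def y_def mult.assoc mult.left_commute)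
        then show ?thesis
          by (simp add: power_mono)
      qed
      then have "(\<integral>\<^sup>+ x. ennreal (norm (hz (X t \<omega>) x) powr 2) \<partial>D) \<le> (\<integral>\<^sup>+ x. ennreal ((2 * \<theta> * L * \<gamma>)\<^sup>2) \<partial>D)"
        by (intro nn_integral_mono ennreal_leI) auto
      then show ?thesis
        by (simp add: D.emeasure_space_1)
    qed
    note * = discounted_noise_moment[OF D.prob_space_axioms iid ad N_proj(5) hz_meas mean bound,
      where \<theta>=\<theta> and t=t, simplified X_def fst_conv snd_conv]
    show "integrable P (z t)"
      by (rule *(1)) (use \<theta> in \<open>auto simp: z_def hz_def\<close>)
    show "(\<integral>\<omega>. norm (z t \<omega>) \<partial>P) \<le> (2 * (2 * \<theta> * L * \<gamma>)\<^sup>2 / (1 - \<theta>)) powr (1 / 2)"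
      by (rule *(2)) (use \<theta> in \<open>auto simp: z_def hz_def\<close>)
  qed
  have U: "(\<integral>\<omega>. norm (u t \<omega>) \<partial>P) \<le> 2 * (1 - \<theta>) powr ((p - 1) / p) * \<sigma>" for t
  proof -
    have "2 * ((1 - \<theta>) * \<sigma>) powr p / (1 - \<theta>) = 2 * (1 - \<theta>) powr (p - 1) * \<sigma> powr p"
      using \<theta> \<sigma> by (simp add: powr_mult powr_diff)
    then have "(2 * ((1 - \<theta>) * \<sigma>) powr p / (1 - \<theta>)) powr (1 / p)
        = 2 powr (1 / p) * (1 - \<theta>) powr ((p - 1) / p) * \<sigma>"
      using \<theta> \<sigma> p by (simp add: powr_mult powr_powr)
    \<comment> \<open>Rounding \<open>2 powr (1 / p)\<close> up to 2 and doubling it by the descent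
      inequality gives the constant 4 of the conclusion.\<close>
    also have "\<dots> \<le> 2 powr 1 * (1 - \<theta>) powr ((p - 1) / p) * \<sigma>"
      using p \<theta> \<sigma> by (intro mult_right_mono powr_mono) auto
    finally show ?thesis
      using u_bound[of t] by simp
  qed
  have Z: "(\<integral>\<omega>. norm (z t \<omega>) \<partial>P) \<le> sqrt 8 * \<theta> * L * \<gamma> / sqrt (1 - \<theta>)" for t
  proof -
    have "(2 * (2 * \<theta> * L * \<gamma>)\<^sup>2 / (1 - \<theta>)) powr (1 / 2) = sqrt (8 * (\<theta> * L * \<gamma>)\<^sup>2 / (1 - \<theta>))"
      using \<theta> by (simp add: powr_half_sqrt power_mult_distrib mult.assoc)
    also have "\<dots> = sqrt 8 * \<theta> * L * \<gamma> / sqrt (1 - \<theta>)"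
      using \<theta> L \<gamma> by (simp add: real_sqrt_mult real_sqrt_divide)
    finally show ?thesis
      using z_bound[of t] by simp
  qed

  have err: "m t \<omega> - g (w t \<omega>) = u t \<omega> + z t \<omega> - \<theta> ^ t *\<^sub>R g w0" if "\<omega> \<in> space P" for t \<omega>
  proof (induction t)
    case 0
    then show ?case
      by (simp add: w0 that u_def z_def)
  next
    case (Suc t)
    have "u (Suc t) \<omega> + z (Suc t) \<omega> - \<theta> ^ Suc t *\<^sub>R g w0
      = \<theta> *\<^sub>R (u t \<omega> + z t \<omega> - \<theta> ^ t *\<^sub>R g w0)
        + (1 - \<theta>) *\<^sub>R (G (w (Suc t) \<omega>) (\<xi> (Suc t) \<omega>) - g (w (Suc t) \<omega>))
        + \<theta> *\<^sub>R (G (w (Suc t) \<omega>) (\<xi> (Suc t) \<omega>) - G (w t \<omega>) (\<xi> (Suc t) \<omega>)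
        - (g (w (Suc t) \<omega>) - g (w t \<omega>)))"
      by (simp add: u_def z_def algebra_simps)
    also have "\<dots> = m (Suc t) \<omega> - g (w (Suc t) \<omega>)"
      unfolding Suc[symmetric] m_Suc[OF that] by (simp add: algebra_simps)
    finally show ?case
      by simp
  qed
  define \<Delta> where "\<Delta> = F w0 - (INF v. F v)"
  \<comment> \<open>\<open>R T\<close> is an integrable pathwise majorant of the weighted gradient
    sum; it serves both to bound the expectations and to show that they exist.\<close>
  define R where "R T \<omega> = \<Delta>
      + (\<Sum>t = 1..T. 2 * \<gamma> * (norm (u t \<omega>) + norm (z t \<omega>) + \<theta> ^ t * norm (g w0)) + L / 2 * \<gamma>\<^sup>2)" for T \<omega>
  have descent: "(\<Sum>t = 1..T. \<gamma> * norm (g (w t \<omega>))) \<le> R T \<omega>" if \<omega>: "\<omega> \<in> space P" for T \<omega>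
  proof -
    have diff: "F differentiable (at v)" for v
      using obj by (simp add: stochastic_objective_def F_def)
    have "F (w (Suc T) \<omega>) + (\<Sum>t = 1..T. \<gamma> * norm (g (w t \<omega>)))
      \<le> F w0 + (\<Sum>t = 1..T. 2 * \<gamma> * (norm (u t \<omega>) + norm (z t \<omega>) + \<theta> ^ t * norm (g w0)) + L / 2 * \<gamma>\<^sup>2)"
    \<comment> \<open>The base case is \<open>w 1 = w0\<close>: the first actual step is the one
      from index 1.\<close>
    proof (induction T)
      case (Suc T)
      let ?t = "Suc T"
      have "norm (m ?t \<omega> - g (w ?t \<omega>)) \<le> norm (u ?t \<omega> + z ?t \<omega>) + norm (\<theta> ^ ?t *\<^sub>R g w0)"
        unfolding err[OF \<omega>] by (rule norm_triangle_ineq4)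
      also have "\<dots> \<le> norm (u ?t \<omega>) + norm (z ?t \<omega>) + \<theta> ^ ?t * norm (g w0)"
        using norm_triangle_ineq[of "u ?t \<omega>" "z ?t \<omega>"] \<theta> by (simp add: abs_mult)
      finally have "2 * \<gamma> * norm (m ?t \<omega> - g (w ?t \<omega>))
          \<le> 2 * \<gamma> * (norm (u ?t \<omega>) + norm (z ?t \<omega>) + \<theta> ^ ?t * norm (g w0))"
        using \<gamma> by (intro mult_left_mono) auto
      moreover have "F (w (Suc ?t) \<omega>) \<le> F (w ?t \<omega>) - \<gamma> * norm (g (w ?t \<omega>))
          + 2 * \<gamma> * norm (m ?t \<omega> - g (w ?t \<omega>)) + L / 2 * \<gamma>\<^sup>2"
        unfolding w_Suc[OF \<omega>] g_def
        using L \<gamma> g_lip by (intro normalized_step_descent diff) (auto simp: g_def)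
      ultimately show ?case
        using Suc by (simp del: power_Suc)
    qed (simp add: w0 \<omega>)
    moreover have "(INF v. F v) \<le> F (w (Suc T) \<omega>)"
      using bdd by (intro cINF_lower) auto
    ultimately show ?thesis
      by (simp add: R_def \<Delta>_def)
  qed
  have R_int: "integrable P (R T)" for T
    unfolding R_def using u_int z_int by auto
  \<comment> \<open>A single gradient norm is one nonnegative summand of the sum dominated by
    \<open>R t\<close>.\<close>
  have g_int: "integrable P (\<lambda>\<omega>. norm (g (w t \<omega>)))" if "t \<ge> 1" for t
  proof (rule Bochner_Integration.integrable_bound)
    show "integrable P (\<lambda>\<omega>. R t \<omega> / \<gamma>)"
      using R_int by simp
    show "AE \<omega> in P. norm (norm (g (w t \<omega>))) \<le> norm (R t \<omega> / \<gamma>)"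
    proof (intro AE_I2)
      fix \<omega>
      assume \<omega>: "\<omega> \<in> space P"
      have "\<gamma> * norm (g (w t \<omega>)) \<le> (\<Sum>t = 1..t. \<gamma> * norm (g (w t \<omega>)))"
        using that \<gamma> by (intro member_le_sum) auto
      also have "\<dots> \<le> R t \<omega>"
        by (rule descent[OF \<omega>])
      finally have "norm (g (w t \<omega>)) \<le> R t \<omega> / \<gamma>"
        using \<gamma> by (simp add: field_simps)
      also have "\<dots> \<le> \<bar>R t \<omega> / \<gamma>\<bar>"
        by (rule abs_ge_self)
      finally show "norm (norm (g (w t \<omega>))) \<le> norm (R t \<omega> / \<gamma>)"
        by simp
    qed
  qed measurable
  have "\<gamma> * (\<Sum>t = 1..T. \<integral>\<omega>. norm (g (w t \<omega>)) \<partial>P) = (\<integral>\<omega>. (\<Sum>t = 1..T. \<gamma> * norm (g (w t \<omega>))) \<partial>P)"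
    using g_int by (subst Bochner_Integration.integral_sum) (auto simp: sum_distrib_left)
  also have "\<dots> \<le> (\<integral>\<omega>. R T \<omega> \<partial>P)"
    using g_int R_int descent by (intro integral_mono) auto
  also have "\<dots> = \<Delta>
      + (\<Sum>t = 1..T. 2 * \<gamma> * ((\<integral>\<omega>. norm (u t \<omega>) \<partial>P) + (\<integral>\<omega>. norm (z t \<omega>) \<partial>P)
          + \<theta> ^ t * norm (g w0)) + L / 2 * \<gamma>\<^sup>2)"
    unfolding R_def using u_int z_int by (simp add: P.prob_space)
  also have "\<dots> \<le> \<Delta>
      + (\<Sum>t = 1..T. 2 * \<gamma> * (2 * (1 - \<theta>) powr ((p - 1) / p) * \<sigma> + sqrt 8 * \<theta> * L * \<gamma> / sqrt (1 - \<theta>)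
          + \<theta> ^ t * norm (g w0)) + L / 2 * \<gamma>\<^sup>2)"
    using U Z \<gamma> by (intro add_left_mono sum_mono add_right_mono mult_left_mono add_mono) auto
  also have "\<dots> = \<gamma> * ((\<Delta>) / \<gamma> + 2 * norm (g w0) * (\<Sum>t = 1..T. \<theta> ^ t)
      + real T * (4 * (1 - \<theta>) powr ((p - 1) / p) * \<sigma>
          + 2 * sqrt 8 * \<theta> * L * \<gamma> / sqrt (1 - \<theta>) + L * \<gamma> / 2))"
    using \<gamma> by (simp add: sum.distrib sum_distrib_left sum_distrib_right algebra_simps power2_eq_square)
  finally show ?thesis
    using \<gamma> by (simp add: g_def \<Delta>_def)
qed

section \<open>Substitution of the chosen parameters\<close>

text \<open>A deterministic computation, with \<open>K\<close> standing for the power of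
  \<open>B / L + 1\<close>. Two regimes are separated by whether \<open>\<sigma> * T\<close> exceeds
  1, that is, by which argument of the minimum is active.\<close>

lemma step_size_bound:
  fixes \<sigma> p L \<theta> \<gamma> \<Delta> n K :: real and T :: nat
  assumes \<sigma>: "\<sigma> > 0" and p: "1 < p" "p \<le> 2" and L: "L > 0" and T: "T \<ge> 1"
    and nonneg: "\<Delta> \<ge> 0" "n \<ge> 0" and K: "K \<ge> 1"
    and \<theta>: "1 - \<theta> = min (1 / (\<sigma> powr (p / (2 * p - 1)) * real T powr (p / (2 * p - 1)))) 1"
    and \<gamma>: "\<gamma> = root 4 (1 - \<theta>) / (L * sqrt (real T))"
  shows "1 / real T * (\<Delta> / \<gamma> + 2 * n * (\<Sum>t = 1..T. \<theta> ^ t)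
      + real T * (4 * (1 - \<theta>) powr ((p - 1) / p) * \<sigma>
          + 2 * sqrt 8 * \<theta> * L * \<gamma> / sqrt (1 - \<theta>) + L * \<gamma> / 2))
    \<le> (2 * n * \<sigma> powr (p / (2 * p - 1)) + 4 * K * \<sigma> powr (p / (2 * p - 1))
        + 4 * K * \<sigma> powr (p / (4 * (2 * p - 1)))) / real T powr ((p - 1) / (2 * p - 1))
      + (L * \<Delta> + 5) * \<sigma> powr (p / (4 * (2 * p - 1))) / real T powr ((p - 1) / (2 * p - 1))
      + (L * \<Delta> + 4 * K + 5) / sqrt (real T) + 2 * n / real T"
proof -
  define a c \<eta> where "a = p / (2 * p - 1)" and "c = (p - 1) / (2 * p - 1)" and "\<eta> = 1 - \<theta>"
  have a4: "p / (4 * (2 * p - 1)) = a / 4"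
    by (simp add: a_def)
  have ac: "a + c = 1" "a > 0" "c > 0"
    using p by (auto simp: a_def c_def add_divide_distrib[symmetric])
  \<comment> \<open>This exponent comparison lets the step-size terms decay at least at the rate
    \<open>T powr (- c)\<close>; it is an equality exactly at \<open>p = 2\<close>.\<close>
  have "a / 4 - 1 / 2 + c = (p - 2) / (4 * (2 * p - 1))"
    using p by (simp add: a_def c_def divide_simps) (simp add: algebra_simps)
  also have "\<dots> \<le> 0"
    using p by (intro divide_nonpos_pos) auto
  finally have a4_le: "a / 4 - 1 / 2 \<le> - c"
    by simp
  define \<tau> where "\<tau> = real T"
  have \<tau>: "\<tau> \<ge> 1" "\<tau> > 0"
    using T by (auto simp: \<tau>_def)
  have \<eta>_min: "\<eta> = min (1 / (\<sigma> powr a * \<tau> powr a)) 1"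
    using \<theta> by (simp add: \<eta>_def a_def \<tau>_def)
  then have \<eta>: "0 < \<eta>" "\<eta> \<le> 1"
    using \<sigma> \<tau> by auto
  have root: "root 4 \<eta> = \<eta> powr (1 / 4)"
    using \<eta> by (simp add: root_powr_inverse)
  have \<gamma>': "\<gamma> = \<eta> powr (1 / 4) / (L * sqrt \<tau>)"
    using \<gamma> root by (simp add: \<eta>_def \<tau>_def)
  have \<Delta>\<gamma>: "\<Delta> / \<gamma> / \<tau> = L * \<Delta> * (\<eta> powr (- 1 / 4) / sqrt \<tau>)"
  proof -
    have "\<eta> powr (- 1 / 4) = inverse (\<eta> powr (1 / 4))"
      using powr_minus[of \<eta> "1 / 4"] by simp
    moreover have "\<Delta> / (e / (L * s)) / \<tau> = L * \<Delta> * (inverse e * (s / \<tau>))" for e s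
      by (simp add: divide_inverse)
    ultimately have "\<Delta> / \<gamma> / \<tau> = L * \<Delta> * (\<eta> powr (- 1 / 4) * (sqrt \<tau> / \<tau>))"
      by (simp only: \<gamma>')
    also have "sqrt \<tau> / \<tau> = 1 / sqrt \<tau>"
      using \<tau> by (subst frac_eq_eq) auto
    finally show ?thesis
      by simp
  qed
  have L\<gamma>: "L * \<gamma> = \<eta> powr (1 / 4) / sqrt \<tau>"
    using L by (simp add: \<gamma>')
  also have "\<dots> \<le> 1 / sqrt \<tau>"
    using \<eta> \<tau> powr_mono2[of "1/4" \<eta> 1] by (intro divide_right_mono) auto
  finally have L\<gamma>_le: "L * \<gamma> \<le> 1 / sqrt \<tau>" .
  \<comment> \<open>The fourth root in \<gamma> balances two terms: this one and
    \<open>\<Delta> / \<gamma> / \<tau>\<close> both scale like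
    \<open>\<eta> powr (- 1 / 4) / sqrt \<tau>\<close>.\<close>
  have "L * \<gamma> / sqrt \<eta> = \<eta> powr (1 / 4) / \<eta> powr (1 / 2) / sqrt \<tau>"
    using \<eta> by (simp add: L\<gamma> powr_half_sqrt)
  also have "\<eta> powr (1 / 4) / \<eta> powr (1 / 2) = \<eta> powr (- 1 / 4)"
    by (simp add: powr_diff[symmetric])
  finally have L\<gamma>_div: "L * \<gamma> / sqrt \<eta> = \<eta> powr (- 1 / 4) / sqrt \<tau>" .
  define S where "S = (\<Sum>t = 1..T. \<theta> ^ t)"
  define U where "U = 4 * \<eta> powr ((p - 1) / p) * \<sigma>"
  define W where "W = \<theta> * (L * \<gamma> / sqrt \<eta>)"
  have lhs: "1 / real T * (\<Delta> / \<gamma> + 2 * n * (\<Sum>t = 1..T. \<theta> ^ t)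
      + real T * (4 * (1 - \<theta>) powr ((p - 1) / p) * \<sigma>
          + 2 * sqrt 8 * \<theta> * L * \<gamma> / sqrt (1 - \<theta>) + L * \<gamma> / 2))
    = L * \<Delta> * (\<eta> powr (- 1 / 4) / sqrt \<tau>) + 2 * n * (S / \<tau>) + U + 2 * sqrt 8 * W + L * \<gamma> / 2"
    unfolding \<Delta>\<gamma>[symmetric] using \<tau>
    by (simp add: S_def U_def W_def \<eta>_def \<tau>_def field_simps)
  have "L * \<Delta> * (\<eta> powr (- 1 / 4) / sqrt \<tau>) + 2 * n * (S / \<tau>) + U + 2 * sqrt 8 * W + L * \<gamma> / 2
    \<le> (2 * n * \<sigma> powr a + 4 * K * \<sigma> powr a + 4 * K * \<sigma> powr (a / 4)) / \<tau> powr c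
      + (L * \<Delta> + 5) * \<sigma> powr (a / 4) / \<tau> powr c
      + (L * \<Delta> + 4 * K + 5) / sqrt \<tau> + 2 * n / \<tau>" (is "?lhs \<le> ?rhs")
  proof (cases "\<sigma> * \<tau> \<le> 1")
    \<comment> \<open>Small noise: \<theta> is 0, the sum \<open>S\<close> vanishes since it starts
      at \<open>t = 1\<close>, and \<open>W\<close> vanishes too. Everything left fits into the term
      of order \<open>1 / sqrt \<tau>\<close>.\<close>
    case True
    then have "\<sigma> powr a * \<tau> powr a \<le> 1"
      using powr_mono2[of a "\<sigma> * \<tau>" 1] ac \<sigma> \<tau> by (simp add: powr_mult)
    then have "\<eta> = 1"
      using \<sigma> \<tau> by (simp add: \<eta>_min min_def field_simps)
    then have "\<theta> = 0"
      by (simp add: \<eta>_def)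
    then have "S = 0" "W = 0"
      by (auto simp: S_def W_def power_0_left)
    have "\<sigma> \<le> 1 / \<tau>"
      using True \<tau> by (simp add: field_simps)
    also have "\<dots> \<le> 1 / sqrt \<tau>"
      using \<tau> by (intro divide_left_mono) (auto simp: real_le_lsqrt power2_eq_square)
    finally have "U \<le> 4 / sqrt \<tau>"
      by (simp add: U_def \<open>\<eta> = 1\<close>)
    then have "?lhs \<le> L * \<Delta> / sqrt \<tau> + 4 / sqrt \<tau> + 1 / sqrt \<tau> / 2"
      using L\<gamma>_le by (simp add: \<open>\<eta> = 1\<close> \<open>S = 0\<close> \<open>W = 0\<close>)
    also have "\<dots> \<le> (L * \<Delta> + 4 * K + 5) / sqrt \<tau>"
    proof -
      have "L * \<Delta> / sqrt \<tau> + 4 / sqrt \<tau> + 1 / sqrt \<tau> / 2 = (L * \<Delta> + 4 + 1 / 2) / sqrt \<tau>"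
        by (simp add: add_divide_distrib)
      also have "\<dots> \<le> (L * \<Delta> + 4 * K + 5) / sqrt \<tau>"
        using K \<tau> by (intro divide_right_mono) auto
      finally show ?thesis .
    qed
    moreover have "0 \<le> (2 * n * \<sigma> powr a + 4 * K * \<sigma> powr a + 4 * K * \<sigma> powr (a / 4)) / \<tau> powr c"
      "0 \<le> (L * \<Delta> + 5) * \<sigma> powr (a / 4) / \<tau> powr c" "0 \<le> 2 * n / \<tau>"
      using nonneg L K \<tau>
      by (auto intro!: add_nonneg_nonneg divide_nonneg_nonneg mult_nonneg_nonneg)
    ultimately show ?thesis
      by linarith
  next
    case False
    then have "1 \<le> \<sigma> powr a * \<tau> powr a"
      using powr_mono2[of a 1 "\<sigma> * \<tau>"] ac \<sigma> \<tau> by (simp add: powr_mult)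
    then have \<eta>_eq: "\<eta> = \<sigma> powr (- a) * \<tau> powr (- a)"
      using \<sigma> \<tau> by (simp add: \<eta>_min min_def powr_minus field_simps)
    have \<theta>01: "0 \<le> \<theta>" "\<theta> < 1"
      using \<eta> by (auto simp: \<eta>_def)
    \<comment> \<open>Comparison with the geometric series; dividing by \<tau> leaves the exponent
      \<open>a - 1 = - c\<close>.\<close>
    have "S \<le> 1 / \<eta>"
    proof -
      have "S \<le> (\<Sum>t<Suc T. \<theta> ^ t)"
        unfolding S_def using \<theta>01 by (intro sum_mono2) auto
      also have "\<dots> = (1 - \<theta> ^ Suc T) / \<eta>"
        unfolding \<eta>_def using \<theta>01 by (subst geometric_sum) (auto simp: divide_simps algebra_simps)
      also have "\<dots> \<le> 1 / \<eta>"
        using \<eta> \<theta>01 by (intro divide_right_mono) auto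
      finally show ?thesis .
    qed
    then have "S / \<tau> \<le> 1 / \<eta> / \<tau>"
      using \<tau> by (intro divide_right_mono) auto
    also have "\<dots> = \<sigma> powr a * (\<tau> powr a / \<tau> powr 1)"
      using \<sigma> \<tau> by (simp add: \<eta>_eq powr_minus field_simps)
    also have "\<tau> powr a / \<tau> powr 1 = \<tau> powr (- c)"
    proof -
      have "a - 1 = - c"
        using ac by simp
      then show ?thesis
        by (simp only: powr_diff[symmetric])
    qed
    finally have S_le: "S / \<tau> \<le> \<sigma> powr a / \<tau> powr c"
      using \<tau> by (simp add: powr_minus divide_inverse)
    \<comment> \<open>The choice of \<theta> makes \<open>a * (p - 1) / p = c\<close>, so the noise
      term has the same order as the bias term \<open>S / \<tau>\<close>.\<close>
    have "\<eta> powr ((p - 1) / p) = \<sigma> powr (- c) * \<tau> powr (- c)"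
      using \<sigma> \<tau> p by (simp add: \<eta>_eq powr_mult powr_powr a_def c_def)
    then have "U = 4 * (\<sigma> powr (- c) * \<sigma> powr 1) * \<tau> powr (- c)"
      using \<sigma> by (simp add: U_def)
    also have "\<sigma> powr (- c) * \<sigma> powr 1 = \<sigma> powr a"
    proof -
      have "- c + 1 = a"
        using ac by simp
      then show ?thesis
        by (simp only: powr_add[symmetric])
    qed
    finally have U_eq: "U = 4 * (\<sigma> powr a / \<tau> powr c)"
      using \<tau> by (simp add: powr_minus divide_inverse)
    define Q where "Q = \<sigma> powr (a / 4) / \<tau> powr c"
    have "Q \<ge> 0"
      by (simp add: Q_def)
    have "\<eta> powr (- 1 / 4) / sqrt \<tau> = \<sigma> powr (a / 4) * (\<tau> powr (a / 4) / \<tau> powr (1 / 2))"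
      using \<sigma> \<tau> by (simp add: \<eta>_eq powr_mult powr_powr powr_half_sqrt)
    also have "\<dots> = \<sigma> powr (a / 4) * \<tau> powr (a / 4 - 1 / 2)"
      by (simp add: powr_diff)
    also have "\<dots> \<le> \<sigma> powr (a / 4) * \<tau> powr (- c)"
      using \<tau> a4_le by (intro mult_left_mono powr_mono) auto
    also have "\<dots> = Q"
      by (simp add: Q_def powr_minus_divide)
    finally have Q: "\<eta> powr (- 1 / 4) / sqrt \<tau> \<le> Q" .
    have "W \<le> 1 * (\<eta> powr (- 1 / 4) / sqrt \<tau>)"
      unfolding W_def L\<gamma>_div using \<theta>01 \<tau> by (intro mult_right_mono) auto
    with Q have "W \<le> Q"
      by simp
    \<comment> \<open>The constant \<open>2 * sqrt 8\<close> is at most 6, hence at most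
      \<open>4 * K + 5\<close>. Its share \<open>4 * K\<close> goes to the first fraction of the
      bound and its share 5 to the second.\<close>
    have "sqrt 8 \<le> 3"
      by (rule real_le_lsqrt) auto
    then have "2 * sqrt 8 * W \<le> 6 * Q"
      using \<open>W \<le> Q\<close> \<open>Q \<ge> 0\<close> L\<gamma>_div \<theta>01 \<tau> by (intro mult_mono) (auto simp: W_def)
    also have "\<dots> \<le> (4 * K + 5) * Q"
      using K \<open>Q \<ge> 0\<close> by (intro mult_right_mono) auto
    finally have W_le: "2 * sqrt 8 * W \<le> (4 * K + 5) * Q" .
    have 1: "L * \<Delta> * (\<eta> powr (- 1 / 4) / sqrt \<tau>) \<le> L * \<Delta> * Q"
      using Q L nonneg by (intro mult_left_mono) auto
    have 2: "2 * n * (S / \<tau>) \<le> 2 * n * (\<sigma> powr a / \<tau> powr c)"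
      using S_le nonneg by (intro mult_left_mono) auto
    have 3: "U \<le> 4 * K * (\<sigma> powr a / \<tau> powr c)"
      unfolding U_eq using K by (intro mult_right_mono) auto
    have "0 \<le> 1 / sqrt \<tau>"
      using \<tau> by simp
    then have "L * \<gamma> / 2 \<le> 1 / sqrt \<tau>"
      using L\<gamma>_le by linarith
    also have "\<dots> \<le> (L * \<Delta> + 4 * K + 5) / sqrt \<tau>"
    proof (intro divide_right_mono)
      have "0 \<le> L * \<Delta>"
        using L nonneg by simp
      then show "1 \<le> L * \<Delta> + 4 * K + 5"
        using K by linarith
    qed (use \<tau> in simp)
    finally have 4: "L * \<gamma> / 2 \<le> (L * \<Delta> + 4 * K + 5) / sqrt \<tau>" .
    have "0 \<le> 2 * n / \<tau>"
      using nonneg \<tau> by simp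
    with 1 2 3 4 W_le have "?lhs \<le> L * \<Delta> * Q + 2 * n * (\<sigma> powr a / \<tau> powr c)
        + 4 * K * (\<sigma> powr a / \<tau> powr c) + (4 * K + 5) * Q
        + (L * \<Delta> + 4 * K + 5) / sqrt \<tau> + 2 * n / \<tau>"
      by linarith
    also have "\<dots> = ?rhs"
      by (simp add: Q_def add_divide_distrib distrib_left distrib_right)
    finally show ?thesis .
  qed
  then show ?thesis
    unfolding lhs a4 by (simp add: a_def c_def \<tau>_def)
qed

section \<open>The convergence rate\<close>

theorem theorem2:
  fixes D :: "'x measure"
    and f :: "real ^ 'd \<Rightarrow> 'x \<Rightarrow> real"
    and w0 :: "real ^ 'd"
    and \<sigma> p L B \<theta> \<gamma> :: real
    and T :: nat
    and P :: "'o measure"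
    and \<xi> :: "nat \<Rightarrow> 'o \<Rightarrow> 'x"
    and w m :: "nat \<Rightarrow> 'o \<Rightarrow> real ^ 'd"
  defines "F \<equiv> objective D f"
  defines "\<Delta> \<equiv> F w0 - (INF v. F v)"
  assumes "stochastic_objective D f"
    and "bdd_below (range F)"
    and "heavy_tailed_noise D f \<sigma> p"
    and "individual_Lipschitz D f w0 L B"
    and "T \<ge> 1"
    and "1 - \<theta> = min (1 / (\<sigma> powr (p / (2 * p - 1)) * real T powr (p / (2 * p - 1)))) 1"
    and "\<gamma> = root 4 (1 - \<theta>) / (L * sqrt (real T))"
    and "iid_samples P D \<xi>"
    and "\<forall>\<omega>\<in>space P. NSGD_VR f \<gamma> \<theta> w0 (\<lambda>t. \<xi> t \<omega>) (\<lambda>t. w t \<omega>) (\<lambda>t. m t \<omega>)"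
  shows "1 / real T * (\<Sum>t = 1..T. \<integral>\<omega>. norm (gradient F (w t \<omega>)) \<partial>P)
    \<le> (2 * norm (gradient F w0) * \<sigma> powr (p / (2 * p - 1))
         + 4 * (B / L + 1) powr ((2 - p) / 2) * \<sigma> powr (p / (2 * p - 1))
         + 4 * (B / L + 1) powr ((2 - p) / 2) * \<sigma> powr (p / (4 * (2 * p - 1))))
        / real T powr ((p - 1) / (2 * p - 1))
      + (L * \<Delta> + 5) * \<sigma> powr (p / (4 * (2 * p - 1)))
        / real T powr ((p - 1) / (2 * p - 1))
      + (L * \<Delta> + 4 * (B / L + 1) powr ((2 - p) / 2) + 5) / sqrt (real T)
      + 2 * norm (gradient F w0) / real T"
proof -
  note obj = assms(3) and bdd = assms(4) and noise = assms(5) and lip = assms(6)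
  have \<sigma>: "\<sigma> > 0" and p: "1 < p" "p \<le> 2"
    using noise by (auto simp: heavy_tailed_noise_def)
  have L: "L > 0" and B: "B > 0"
    using lip by (auto simp: individual_Lipschitz_def)
  have "1 - \<theta> > 0" "1 - \<theta> \<le> 1"
    using assms(8) \<sigma> \<open>T \<ge> 1\<close> by auto
  then have \<theta>: "0 \<le> \<theta>" "\<theta> < 1"
    by auto
  have \<gamma>: "\<gamma> > 0"
    using assms(9) \<theta> L \<open>T \<ge> 1\<close> by simp
  have \<Delta>: "\<Delta> \<ge> 0"
    unfolding \<Delta>_def using bdd by (simp add: cINF_lower)
  \<comment> \<open>The base exceeds 1, and the exponent is nonnegative because \<open>p\<close> is
    at most 2.\<close>
  have K: "(B / L + 1) powr ((2 - p) / 2) \<ge> 1"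
    using L B p by (intro ge_one_powr_ge_zero) auto
  have "(\<Sum>t = 1..T. \<integral>\<omega>. norm (gradient F (w t \<omega>)) \<partial>P)
    \<le> \<Delta> / \<gamma> + 2 * norm (gradient F w0) * (\<Sum>t = 1..T. \<theta> ^ t)
      + real T * (4 * (1 - \<theta>) powr ((p - 1) / p) * \<sigma>
          + 2 * sqrt 8 * \<theta> * L * \<gamma> / sqrt (1 - \<theta>) + L * \<gamma> / 2)"
    unfolding \<Delta>_def F_def
    using assms(11) bdd
    by (intro NSGD_VR_average_gradient[OF obj _ noise lip assms(10) _ \<theta> \<gamma>]) (auto simp: F_def)
  then have "1 / real T * (\<Sum>t = 1..T. \<integral>\<omega>. norm (gradient F (w t \<omega>)) \<partial>P)
    \<le> 1 / real T * (\<Delta> / \<gamma> + 2 * norm (gradient F w0) * (\<Sum>t = 1..T. \<theta> ^ t)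
      + real T * (4 * (1 - \<theta>) powr ((p - 1) / p) * \<sigma>
          + 2 * sqrt 8 * \<theta> * L * \<gamma> / sqrt (1 - \<theta>) + L * \<gamma> / 2))"
    by (rule mult_left_mono) simp
  also note step_size_bound[OF \<sigma> p L \<open>T \<ge> 1\<close> \<Delta> norm_ge_zero K assms(8,9)]
  finally show ?thesis .
qed

end
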